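(* Let $(\mathcal{X},\wp)$ be a partial metric space, let $\mathcal{D}$ be a non-empty set, and for each $n\in\mathbb{N}$ let $f_n:\mathcal{D}\to\mathcal{X}$ be a function. If the sequence $\{f_n\}_{n\in\mathbb{N}}$ converges pointwise on $\mathcal{D}$ (to some function $f:\mathcal{D}\to\mathcal{X}$), then it is pointwise Cauchy on $\mathcal{D}$.
   Context: A partial metric on a non-empty set $\mathcal{X}$ is a map $\wp:\mathcal{X}\times\mathcal{X}\to\mathbb{R}$ such that for all $x,y,z\in\mathcal{X}$: (1) $x=y$ if and only if $\wp(x,x)=\wp(x,y)=\wp(y,y)$; (2) $0\le \wp(x,x)\le\wp(x,y)$; (3) $\wp(x,y)=\wp(y,x)$; (4) $\wp(x,y)\le\wp(x,z)+\wp(z,y)-\wp(z,z)$. The pair $(\mathcal{X},\wp)$ is called a partial metric space. A sequence of functions $f_n:\mathcal{D}\to\mathcal{X}$ converges pointwise on $\mathcal{D}$ to $f:\mathcal{D}\to\mathcal{X}$ if for each $x\in\mathcal{D}$, $\lim_{n\to\infty}\wp(f_n(x),f(x))=\lim_{n\to\infty}\wp(f_n(x),f_n(x))=\wp(f(x),f(x))$. The sequence $\{f_n\}$ is pointwise Cauchy on $\mathcal{D}$ if for each $x\in\mathcal{D}$ there is a real number $l=l(x)\ge 0$ such that for each $\epsilon>0$ there exists $k=k(\epsilon,x)\in\mathbb{N}$ with $|\wp(f_m(x),f_n(x))-l|<\epsilon$ for all $m,n\ge k$. *)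

theory Defs
  imports Complex_Main "HOL-Library.FuncSet"
begin

(* As with Metric_space in HOL-Analysis, the space is a carrier set; only the values of p on
   the carrier matter. *)
locale partial_metric_space =
  fixes X :: "'a set" and p :: "'a \<Rightarrow> 'a \<Rightarrow> real"
  assumes nonempty: "X \<noteq> {}"
    and eq_iff: "\<And>x y. \<lbrakk>x \<in> X; y \<in> X\<rbrakk> \<Longrightarrow> x = y \<longleftrightarrow> p x x = p x y \<and> p x y = p y y"
    and self_nonneg: "\<And>x. x \<in> X \<Longrightarrow> 0 \<le> p x x"
    and self_le: "\<And>x y. \<lbrakk>x \<in> X; y \<in> X\<rbrakk> \<Longrightarrow> p x x \<le> p x y"
    and commute: "\<And>x y. \<lbrakk>x \<in> X; y \<in> X\<rbrakk> \<Longrightarrow> p x y = p y x"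
    and triangle: "\<And>x y z. \<lbrakk>x \<in> X; y \<in> X; z \<in> X\<rbrakk> \<Longrightarrow> p x y \<le> p x z + p z y - p z z"

definition pointwise_converges ::
    "('a \<Rightarrow> 'a \<Rightarrow> real) \<Rightarrow> 'd set \<Rightarrow> (nat \<Rightarrow> 'd \<Rightarrow> 'a) \<Rightarrow> ('d \<Rightarrow> 'a) \<Rightarrow> bool" where
  "pointwise_converges p D f g \<longleftrightarrow>
     (\<forall>x\<in>D. (\<lambda>n. p (f n x) (g x)) \<longlonglongrightarrow> p (g x) (g x) \<and>
            (\<lambda>n. p (f n x) (f n x)) \<longlonglongrightarrow> p (g x) (g x))"

definition pointwise_Cauchy ::
    "('a \<Rightarrow> 'a \<Rightarrow> real) \<Rightarrow> 'd set \<Rightarrow> (nat \<Rightarrow> 'd \<Rightarrow> 'a) \<Rightarrow> bool" where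
  "pointwise_Cauchy p D f \<longleftrightarrow>
     (\<forall>x\<in>D. \<exists>l::real. l \<ge> 0 \<and>
        (\<forall>\<epsilon>>0. \<exists>k::nat. \<forall>m\<ge>k. \<forall>n\<ge>k. \<bar>p (f m x) (f n x) - l\<bar> < \<epsilon>))"

end

theory Submission
  imports Defs
begin

text \<open>At each point the Cauchy limit is the self-distance of the limit,
  \<open>p (g x) (g x)\<close>. The triangle inequality through \<open>g x\<close> bounds
  \<open>p (f m x) (f n x)\<close> above by terms tending to that value. Since distances may stay
  positive, a lower bound is also needed: \<open>self_le\<close> gives it, because the
  self-distances \<open>p (f m x) (f m x)\<close> tend to the same value.\<close>

theorem theorem3p3:
  fixes X :: "'a set" and p :: "'a \<Rightarrow> 'a \<Rightarrow> real"
    and D :: "'d set" and f :: "nat \<Rightarrow> 'd \<Rightarrow> 'a"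
  assumes "partial_metric_space X p"
    and "D \<noteq> {}"
    and "\<And>n. f n \<in> D \<rightarrow> X"
    and "\<exists>g \<in> D \<rightarrow> X. pointwise_converges p D f g"
  shows "pointwise_Cauchy p D f"
proof -
  interpret partial_metric_space X p by fact
  obtain g where g: "g \<in> D \<rightarrow> X" and conv: "pointwise_converges p D f g"
    using assms(4) by blast
  show ?thesis
    unfolding pointwise_Cauchy_def
  \<comment> \<open>The \<open>for x\<close> keeps the argument of the witness schematic, so that it
    can become the point fixed below.\<close>
  proof (intro ballI exI[of _ "p (g x) (g x)" for x] conjI allI impI)
    fix x assume x: "x \<in> D"
    have gX: "g x \<in> X" and fX: "f n x \<in> X" for n
      using x g assms(3)[of n] by auto
    show "0 \<le> p (g x) (g x)"
      using gX by (rule self_nonneg)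
    fix \<epsilon> :: real assume "\<epsilon> > 0"
    then have e: "\<epsilon> / 2 > 0" by simp
    have "(\<lambda>n. p (f n x) (g x)) \<longlonglongrightarrow> p (g x) (g x)"
      and "(\<lambda>n. p (f n x) (f n x)) \<longlonglongrightarrow> p (g x) (g x)"
      using conv x by (auto simp: pointwise_converges_def)
    then obtain k1 k2
      where k1: "\<And>n. n \<ge> k1 \<Longrightarrow> \<bar>p (f n x) (g x) - p (g x) (g x)\<bar> < \<epsilon> / 2"
        and k2: "\<And>n. n \<ge> k2 \<Longrightarrow> \<bar>p (f n x) (f n x) - p (g x) (g x)\<bar> < \<epsilon> / 2"
      using e unfolding LIMSEQ_iff real_norm_def by meson
    have "\<bar>p (f m x) (f n x) - p (g x) (g x)\<bar> < \<epsilon>"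
      if "m \<ge> max k1 k2" and "n \<ge> max k1 k2" for m n
    proof -
      \<comment> \<open>Exceeds \<open>p (g x) (g x)\<close> by at most two errors, each below
        \<open>\<epsilon> / 2\<close> by \<open>k1\<close>.\<close>
      have "p (f m x) (f n x) \<le> p (f m x) (g x) + p (f n x) (g x) - p (g x) (g x)"
        using triangle[OF fX[of m] fX[of n] gX] commute[OF gX fX[of n]] by simp
      \<comment> \<open>By \<open>k2\<close> the left side is above
        \<open>p (g x) (g x) - \<epsilon> / 2\<close>.\<close>
      moreover have "p (f m x) (f m x) \<le> p (f m x) (f n x)"
        by (rule self_le[OF fX fX])
      ultimately show ?thesis
        using k1[of m] k1[of n] k2[of m] that by (simp add: abs_if split: if_splits)
    qed
    then show "\<exists>k. \<forall>m\<ge>k. \<forall>n\<ge>k. \<bar>p (f m x) (f n x) - p (g x) (g x)\<bar> < \<epsilon>"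
      by blast
  qed
qed

end
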